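(* Let $G$ be a group, and let $K \le Z(G)$. Let $$\Delta : G/K \times G/K \to K$$ be a bi-homomorphism, that is, a function that is a homomorphism in each of the two variables. Then the function $\gamma$ from $G$ to the set $G^{G}$ of maps from $G$ to $G$, given by $$x^{\gamma(y)} = \Delta(x K, y K)\, x \quad \text{for } x, y \in G,$$ is a bi-GF on $G$ (in particular it takes values in $\operatorname{Aut}(G)$), and it satisfies the following conditions: $\gamma : (G,\cdot) \to \operatorname{Aut}(G,\cdot)$ is a homomorphism, $\gamma(G)$ is abelian, and $\gamma : (G,\cdot) \to \operatorname{Aut}(G,\cdot)$ is an anti-homomorphism.
   Context: Maps act on the right and are written as exponents ($x^{\gamma(y)}$ is the image of $x$ under the map $\gamma(y)$), and products of maps are composed left to right. A gamma function (GF) on a group $G$ is a function $\gamma : G \to \operatorname{Aut}(G)$ such that $\gamma(g^{\gamma(h)} h) = \gamma(g)\gamma(h)$ for all $g,h \in G$. A bi-GF on $G$ is a gamma function $\gamma$ on $G$ which is an anti-homomorphism, i.e. $\gamma(xy) = \gamma(y)\gamma(x)$ for all $x,y \in G$; equivalently, a gamma function such that, with $x \circ y = x^{\gamma(y)} y$, both $(G,\cdot,\circ)$ and $(G,\circ,\cdot)$ are (right) skew braces. Here a (right) skew brace is a triple $(G,\cdot,\circ)$ where $(G,\cdot)$, $(G,\circ)$ are groups and $(x y) \circ z = (x \circ z) \cdot z^{-1} \cdot (y \circ z)$ for all $x,y,z\in G$, with $z^{-1}$ the inverse in $(G,\cdot)$. *)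

theory Defs
  imports "HOL-Algebra.Algebra"
begin

definition center :: "('a, 'b) monoid_scheme \<Rightarrow> 'a set" where
  "center G = {z \<in> carrier G. \<forall>x \<in> carrier G. z \<otimes>\<^bsub>G\<^esub> x = x \<otimes>\<^bsub>G\<^esub> z}"

text \<open>Maps act on the right, so \<open>x\<^sup>f\<close> is rendered as \<open>f x\<close>, and products of maps are composed from left to
  right. The product of \<^const>\<open>AutoGroup\<close> composes from right to left, so \<open>Aut(G)\<close> is its opposite:
  the product of \<open>f\<close> and \<open>g\<close> is \<open>f\<close> followed by \<open>g\<close>. As in \<^const>\<open>AutoGroup\<close>, automorphisms are
  extensional, that is, \<^const>\<open>undefined\<close> outside the carrier.\<close>

definition right_Aut :: "('a, 'b) monoid_scheme \<Rightarrow> ('a \<Rightarrow> 'a) monoid" where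
  "right_Aut G = (AutoGroup G)\<lparr>mult := \<lambda>f g. g \<otimes>\<^bsub>AutoGroup G\<^esub> f\<rparr>"

definition anti_hom :: "('a, 'c) monoid_scheme \<Rightarrow> ('b, 'd) monoid_scheme \<Rightarrow> ('a \<Rightarrow> 'b) set" where
  "anti_hom G H = {h. h \<in> carrier G \<rightarrow> carrier H \<and>
     (\<forall>x \<in> carrier G. \<forall>y \<in> carrier G. h (x \<otimes>\<^bsub>G\<^esub> y) = h y \<otimes>\<^bsub>H\<^esub> h x)}"

definition bi_hom ::
  "('a, 'd) monoid_scheme \<Rightarrow> ('b, 'e) monoid_scheme \<Rightarrow> ('c, 'f) monoid_scheme \<Rightarrow> ('a \<Rightarrow> 'b \<Rightarrow> 'c) set"
where
  "bi_hom G H L = {D. (\<forall>y \<in> carrier H. (\<lambda>x. D x y) \<in> hom G L) \<and> (\<forall>x \<in> carrier G. D x \<in> hom H L)}"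

definition gamma_function :: "('a, 'b) monoid_scheme \<Rightarrow> ('a \<Rightarrow> 'a \<Rightarrow> 'a) \<Rightarrow> bool" where
  "gamma_function G \<gamma> \<longleftrightarrow> \<gamma> \<in> carrier G \<rightarrow> carrier (right_Aut G) \<and>
     (\<forall>g \<in> carrier G. \<forall>h \<in> carrier G. \<gamma> (\<gamma> h g \<otimes>\<^bsub>G\<^esub> h) = \<gamma> g \<otimes>\<^bsub>right_Aut G\<^esub> \<gamma> h)"

definition bi_GF :: "('a, 'b) monoid_scheme \<Rightarrow> ('a \<Rightarrow> 'a \<Rightarrow> 'a) \<Rightarrow> bool" where
  "bi_GF G \<gamma> \<longleftrightarrow> gamma_function G \<gamma> \<and> \<gamma> \<in> anti_hom G (right_Aut G)"

text \<open>\<open>Mod\<close> is built from right cosets; these agree with the left cosets \<open>x <# K\<close> since \<open>K\<close> is central.\<close>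

definition gamma_of ::
  "('a, 'b) monoid_scheme \<Rightarrow> 'a set \<Rightarrow> ('a set \<Rightarrow> 'a set \<Rightarrow> 'a) \<Rightarrow> 'a \<Rightarrow> 'a \<Rightarrow> 'a" where
  "gamma_of G K \<Delta> = (\<lambda>y \<in> carrier G. \<lambda>x \<in> carrier G. \<Delta> (x <#\<^bsub>G\<^esub> K) (y <#\<^bsub>G\<^esub> K) \<otimes>\<^bsub>G\<^esub> x)"

end

theory Submission
  imports Defs
begin

text \<open>Lift \<open>\<Delta>\<close> to a bi-multiplicative \<open>d\<close> on \<open>G\<close> that is trivial when either argument lies in \<open>K\<close>.
  Factors from \<open>K\<close> therefore do not influence \<open>d\<close>, and \<open>\<gamma>(y)\<close> followed by \<open>\<gamma>(z)\<close> sends \<open>x\<close> to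
  \<open>d(x,y) d(x,z) x\<close>. This is symmetric in \<open>y\<close> and \<open>z\<close> because \<open>K\<close> is central, and it equals
  the image of \<open>x\<close> under \<open>\<gamma>(yz)\<close>; in particular \<open>\<gamma>(y)\<close> is invertible with inverse \<open>\<gamma>(y\<^sup>-\<^sup>1)\<close>.\<close>

lemma bi_hom_Mod_lift:
  fixes G (structure) and K and \<Delta>
  defines "d \<equiv> \<lambda>x y. \<Delta> (x <#\<^bsub>G\<^esub> K) (y <#\<^bsub>G\<^esub> K)"
  assumes G: "group G" and K: "subgroup K G" and cen: "K \<subseteq> center G"
    and \<Delta>: "\<Delta> \<in> bi_hom (G Mod K) (G Mod K) (G\<lparr>carrier := K\<rparr>)"
  shows lift_in_subgroup: "\<And>x y. x \<in> carrier G \<Longrightarrow> y \<in> carrier G \<Longrightarrow> d x y \<in> K"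
    and lift_mult_left: "\<And>x x' y. x \<in> carrier G \<Longrightarrow> x' \<in> carrier G \<Longrightarrow> y \<in> carrier G \<Longrightarrow>
      d (x \<otimes> x') y = d x y \<otimes> d x' y"
    and lift_mult_right: "\<And>x y y'. x \<in> carrier G \<Longrightarrow> y \<in> carrier G \<Longrightarrow> y' \<in> carrier G \<Longrightarrow>
      d x (y \<otimes> y') = d x y \<otimes> d x y'"
    and lift_left_trivial: "\<And>k y. k \<in> K \<Longrightarrow> y \<in> carrier G \<Longrightarrow> d k y = \<one>"
    and lift_right_trivial: "\<And>x k. x \<in> carrier G \<Longrightarrow> k \<in> K \<Longrightarrow> d x k = \<one>"
proof -
  interpret group G by fact
  interpret K: subgroup K G by fact
  \<comment> \<open>\<open>\<Delta>\<close> is evaluated at left cosets, while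
    \<open>G Mod K\<close> consists of right cosets. Centrality identifies the two, and this
    identity is also what makes \<open>K\<close> normal.\<close>
  have coset: "x <#\<^bsub>G\<^esub> K = K #> x" if "x \<in> carrier G" for x
    using that cen unfolding center_def l_coset_def r_coset_def by fastforce
  interpret N: normal K G
    by (rule normalI) (use coset K in auto)
  have in_Mod: "x <#\<^bsub>G\<^esub> K \<in> carrier (G Mod K)" if "x \<in> carrier G" for x
    using that coset by (auto simp: FactGroup_def RCOSETS_def)
  have mult_Mod: "(x \<otimes> y) <#\<^bsub>G\<^esub> K = (x <#\<^bsub>G\<^esub> K) \<otimes>\<^bsub>G Mod K\<^esub> (y <#\<^bsub>G\<^esub> K)"
    if "x \<in> carrier G" "y \<in> carrier G" for x y
    using that coset N.rcos_sum by (simp add: FactGroup_def)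
  have hom_left: "(\<lambda>A. \<Delta> A (y <#\<^bsub>G\<^esub> K)) \<in> hom (G Mod K) (G\<lparr>carrier := K\<rparr>)"
    and hom_right: "\<Delta> (y <#\<^bsub>G\<^esub> K) \<in> hom (G Mod K) (G\<lparr>carrier := K\<rparr>)" if "y \<in> carrier G" for y
    using \<Delta> in_Mod[OF that] by (simp_all add: bi_hom_def)
  show mem: "d x y \<in> K" if "x \<in> carrier G" "y \<in> carrier G" for x y
    using hom_in_carrier[OF hom_left in_Mod] that by (simp add: d_def)
  show left: "d (x \<otimes> x') y = d x y \<otimes> d x' y"
    if "x \<in> carrier G" "x' \<in> carrier G" "y \<in> carrier G" for x x' y
    using hom_mult[OF hom_left in_Mod in_Mod] that by (simp add: d_def mult_Mod)
  show right: "d x (y \<otimes> y') = d x y \<otimes> d x y'"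
    if "x \<in> carrier G" "y \<in> carrier G" "y' \<in> carrier G" for x y y'
    using hom_mult[OF hom_right in_Mod in_Mod] that by (simp add: d_def mult_Mod)
  have k_coset: "k <#\<^bsub>G\<^esub> K = \<one> <#\<^bsub>G\<^esub> K" if "k \<in> K" for k
    using that coset K.mem_carrier coset_join2 K by simp
  \<comment> \<open>Since \<open>k\<close> and \<open>\<one>\<close> have the same coset,
    \<open>d k y = d \<one> y\<close>. By \<open>left\<close>, \<open>d \<one> y\<close> equals its
    own square, so cancelling in the group leaves \<open>\<one>\<close>. The other argument is
    handled in the same way.\<close>
  show "d k y = \<one>" if "k \<in> K" "y \<in> carrier G" for k y
    using left[of \<one> \<one> y] mem[of \<one> y] that k_coset[of k] by (simp add: d_def)
  show "d x k = \<one>" if "x \<in> carrier G" "k \<in> K" for x k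
    using right[of x \<one> \<one>] mem[of x \<one>] that k_coset[of k] by (simp add: d_def)
qed

text \<open>The product of \<open>BijGroup\<close> is a function restricted to \<open>Bij\<close>;
  the two hypotheses allow it to be unfolded. \<open>right_Aut\<close> swaps the factors, so
  \<open>f\<close> is applied first.\<close>

lemma mult_right_Aut:
  assumes "f \<in> auto G" "g \<in> auto G"
  shows "f \<otimes>\<^bsub>right_Aut G\<^esub> g = compose (carrier G) g f"
  using assms by (simp add: right_Aut_def AutoGroup_def BijGroup_def auto_def)

theorem proposition4p7:
  fixes G :: "('a, 'b) monoid_scheme"
    and K :: "'a set"
    and \<Delta> :: "'a set \<Rightarrow> 'a set \<Rightarrow> 'a"
  assumes "group G"
    and "subgroup K G"
    and "K \<subseteq> center G"
    and "\<Delta> \<in> bi_hom (G Mod K) (G Mod K) (G\<lparr>carrier := K\<rparr>)"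
  shows "bi_GF G (gamma_of G K \<Delta>) \<and>
    gamma_of G K \<Delta> \<in> hom G (right_Aut G) \<and>
    comm_group ((right_Aut G)\<lparr>carrier := gamma_of G K \<Delta> ` carrier G\<rparr>) \<and>
    gamma_of G K \<Delta> \<in> anti_hom G (right_Aut G)"
proof -
  interpret group G by fact
  let ?\<gamma> = "gamma_of G K \<Delta>" and ?A = "right_Aut G"
  define d where "d x y = \<Delta> (x <#\<^bsub>G\<^esub> K) (y <#\<^bsub>G\<^esub> K)" for x y
  note lift = bi_hom_Mod_lift[OF assms, folded d_def]
  have \<gamma>: "?\<gamma> y x = d x y \<otimes>\<^bsub>G\<^esub> x" if "x \<in> carrier G" "y \<in> carrier G" for x y
    using that by (simp add: gamma_of_def d_def)
  have K_carrier: "k \<in> carrier G" if "k \<in> K" for k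
    using that assms(2) by (rule subgroup.mem_carrier[rotated])
  have central: "k \<otimes>\<^bsub>G\<^esub> x = x \<otimes>\<^bsub>G\<^esub> k" if "k \<in> K" "x \<in> carrier G" for k x
    using that assms(3) by (auto simp: center_def)
  have d_closed: "d x y \<in> carrier G" if "x \<in> carrier G" "y \<in> carrier G" for x y
    using that lift(1) K_carrier by blast
  have \<gamma>_closed: "?\<gamma> y x \<in> carrier G" if "x \<in> carrier G" "y \<in> carrier G" for x y
    using that by (simp add: \<gamma> d_closed)
  have \<gamma>_comp: "?\<gamma> z (?\<gamma> y x) = ?\<gamma> (y \<otimes>\<^bsub>G\<^esub> z) x"
    if "x \<in> carrier G" "y \<in> carrier G" "z \<in> carrier G" for x y z
  proof -
    \<comment> \<open>The outer map involves \<open>d (d x y \<otimes> x) z\<close>. Its factor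
      \<open>d (d x y) z\<close> is trivial because \<open>d x y\<close> lies in \<open>K\<close>,
      which leaves \<open>d x z\<close>.\<close>
    have "?\<gamma> z (?\<gamma> y x) = d x z \<otimes>\<^bsub>G\<^esub> (d x y \<otimes>\<^bsub>G\<^esub> x)"
      using that by (simp add: \<gamma> d_closed lift)
    also have "\<dots> = d x y \<otimes>\<^bsub>G\<^esub> d x z \<otimes>\<^bsub>G\<^esub> x"
      using that by (simp add: m_assoc[symmetric] d_closed central[of "d x z" "d x y"] lift(1))
    finally show ?thesis
      using that by (simp add: \<gamma> lift)
  qed
  have \<gamma>_one: "?\<gamma> \<one>\<^bsub>G\<^esub> x = x" if "x \<in> carrier G" for x
    using that lift(5)[of x "\<one>\<^bsub>G\<^esub>"] subgroup.one_closed[OF assms(2)] by (simp add: \<gamma>)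
  have \<gamma>_ext: "?\<gamma> y \<in> extensional (carrier G)" if "y \<in> carrier G" for y
    using that by (simp add: gamma_of_def)
  have \<gamma>_mult: "?\<gamma> y (x \<otimes>\<^bsub>G\<^esub> x') = ?\<gamma> y x \<otimes>\<^bsub>G\<^esub> ?\<gamma> y x'"
    if "x \<in> carrier G" "x' \<in> carrier G" "y \<in> carrier G" for x x' y
  proof -
    have "?\<gamma> y (x \<otimes>\<^bsub>G\<^esub> x') = d x y \<otimes>\<^bsub>G\<^esub> (d x' y \<otimes>\<^bsub>G\<^esub> x) \<otimes>\<^bsub>G\<^esub> x'"
      using that by (simp add: \<gamma> lift m_assoc d_closed)
    \<comment> \<open>Multiplicativity of \<open>\<gamma>(y)\<close> rests on centrality: the value
      \<open>d x' y\<close> must move past \<open>x\<close> to stand next to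
      \<open>x'\<close>.\<close>
    also have "d x' y \<otimes>\<^bsub>G\<^esub> x = x \<otimes>\<^bsub>G\<^esub> d x' y"
      using that by (simp add: central lift)
    finally show ?thesis
      using that by (simp add: \<gamma> m_assoc d_closed)
  qed
  have \<gamma>_auto: "?\<gamma> y \<in> auto G" if y: "y \<in> carrier G" for y
  proof -
    have "bij_betw (?\<gamma> y) (carrier G) (carrier G)"
      by (rule bij_betw_byWitness[where f' = "?\<gamma> (inv\<^bsub>G\<^esub> y)"])
        (use y in \<open>auto simp: \<gamma>_comp \<gamma>_one \<gamma>_closed\<close>)
    then show ?thesis
      using y by (simp add: auto_def Bij_def hom_def \<gamma>_ext \<gamma>_mult \<gamma>_closed)
  qed
  have \<gamma>_hom_eq: "?\<gamma> y \<otimes>\<^bsub>?A\<^esub> ?\<gamma> z = ?\<gamma> (y \<otimes>\<^bsub>G\<^esub> z)" if "y \<in> carrier G" "z \<in> carrier G" for y z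
    unfolding mult_right_Aut[OF \<gamma>_auto[OF that(1)] \<gamma>_auto[OF that(2)]]
    by (rule extensionalityI[where A = "carrier G"])
      (use that in \<open>simp_all add: compose_eq \<gamma>_comp \<gamma>_ext\<close>)
  \<comment> \<open>\<open>G\<close> itself may be non-abelian: \<open>y\<close> and
    \<open>z\<close> enter only through \<open>d x y\<close> and \<open>d x z\<close>, which commute
    as elements of the central subgroup \<open>K\<close>.\<close>
  have \<gamma>_commute: "?\<gamma> (y \<otimes>\<^bsub>G\<^esub> z) = ?\<gamma> (z \<otimes>\<^bsub>G\<^esub> y)" if "y \<in> carrier G" "z \<in> carrier G" for y z
    by (rule extensionalityI[where A = "carrier G"])
      (use that in \<open>simp_all add: \<gamma> lift \<gamma>_ext central[of "d _ y" "d _ z"] d_closed\<close>)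
  have \<gamma>_Aut: "?\<gamma> \<in> carrier G \<rightarrow> carrier ?A"
    using \<gamma>_auto by (simp add: right_Aut_def AutoGroup_def)
  have hom: "?\<gamma> \<in> hom G ?A"
    using \<gamma>_Aut by (auto simp: hom_def \<gamma>_hom_eq)
  \<comment> \<open>Given \<open>\<gamma>_commute\<close>, the homomorphism law read for
    \<open>z\<close> and \<open>y\<close> is the anti-homomorphism law.\<close>
  have anti: "?\<gamma> \<in> anti_hom G ?A"
    using \<gamma>_Aut \<gamma>_commute by (simp add: anti_hom_def \<gamma>_hom_eq)
  have gamma_function: "gamma_function G ?\<gamma>"
    unfolding gamma_function_def
  proof (intro conjI ballI \<gamma>_Aut)
    fix g h
    assume gh: "g \<in> carrier G" "h \<in> carrier G"
    \<comment> \<open>The argument on the left is \<open>d g h \<otimes> g \<otimes> h\<close>. Its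
      factor \<open>d g h\<close> lies in \<open>K\<close> and vanishes in the second argument of
      \<open>d\<close>, so the gamma function law reduces to the homomorphism law.\<close>
    have "?\<gamma> (?\<gamma> h g \<otimes>\<^bsub>G\<^esub> h) = ?\<gamma> (g \<otimes>\<^bsub>G\<^esub> h)"
      by (rule extensionalityI[where A = "carrier G"])
        (use gh in \<open>simp_all add: \<gamma> lift \<gamma>_ext d_closed\<close>)
    then show "?\<gamma> (?\<gamma> h g \<otimes>\<^bsub>G\<^esub> h) = ?\<gamma> g \<otimes>\<^bsub>?A\<^esub> ?\<gamma> h"
      using gh by (simp add: \<gamma>_hom_eq)
  qed
  \<comment> \<open>\<open>hom_imp_img_group\<close> makes the image a group whose unit is the image
    of \<open>\<one>\<close>, with no group structure on \<open>right_Aut G\<close> required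
    beforehand. This equation identifies that unit with the one of
    \<open>right_Aut G\<close>.\<close>
  have "?\<gamma> \<one>\<^bsub>G\<^esub> = \<one>\<^bsub>?A\<^esub>"
    by (rule extensionalityI[where A = "carrier G"])
      (simp_all add: \<gamma>_ext \<gamma>_one right_Aut_def AutoGroup_def BijGroup_def)
  then have "group (?A\<lparr>carrier := ?\<gamma> ` carrier G\<rparr>)"
    using hom_imp_img_group[OF hom] by simp
  then have "comm_group (?A\<lparr>carrier := ?\<gamma> ` carrier G\<rparr>)"
    by (rule group.group_comm_groupI) (auto simp: \<gamma>_hom_eq \<gamma>_commute)
  with hom anti gamma_function show ?thesis
    by (simp add: bi_GF_def)
qed

end
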